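(* Let $d\geq 1$ be an arbitrary integer. A sequence $(a_n)_{n=0}^{\infty}\subset S^d$ is a greedy $\lambda$-energy sequence for $\lambda=2$ if and only if $$a_{2k+1}=-a_{2k}\quad\text{for every } k\geq 0.$$ If $(a_n)_{n=0}^{\infty}\subset S^d$ is such a sequence, and $\alpha_{N,2}=(a_0,\ldots,a_{N-1})$, then for each $n\geq 1$, $$H_2(\alpha_{2n,2})=8n^2,\qquad H_2(\alpha_{2n+1,2})=8(n^2+n).$$ For the potential $U_n(x)=\sum_{k=0}^{n-1}|x-a_k|^2$ we have, for each $n\geq 1$, $$U_{2n-1}(a_{2n-1})=U_{2n}(a_{2n})=4n.$$ In particular, $$\lim_{N\to\infty}\frac{H_2(\alpha_{N,2})}{N^2}=\lim_{n\to\infty}\frac{U_n(a_n)}{n}=2.$$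
   Context: $S^d=\{x\in\mathbb{R}^{d+1}:|x|=1\}$, where $|\cdot|$ is the Euclidean norm. For $\lambda>0$, a greedy $\lambda$-energy sequence on $S^d$ is a sequence $(a_n)_{n=0}^{\infty}\subset S^d$ such that $\sum_{k=0}^{n-1}|a_n-a_k|^{\lambda}=\max_{x\in S^d}\sum_{k=0}^{n-1}|x-a_k|^{\lambda}$ for all $n\geq 1$. For a configuration $\omega_N=(y_0,\ldots,y_{N-1})$ of $N\ge2$ points of $S^d$ (not necessarily distinct), $H_2(\omega_N)=\sum_{0\le i\neq j\le N-1}|y_i-y_j|^2$. *)

theory Defs
  imports "HOL-Analysis.Analysis"
begin

text \<open>
  With \<open>CARD('n) = d + 1\<close>, the sphere \<open>S\<^sup>d\<close> is \<open>sphere 0 1\<close> in \<open>real ^ 'n\<close>.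
\<close>

text \<open>
  The exponent \<open>s\<close> is an arbitrary real, hence \<open>powr\<close>; since \<open>0 powr s = 0\<close>, coinciding points contribute 0,
  as they should for \<open>s > 0\<close> (the only range in which the notion is meant to be used).
  The bound over all \<open>x\<close>, together with \<open>a m\<close> lying on the sphere, says that the
  value at \<open>a m\<close> is the maximum over the sphere.
\<close>
definition greedy_energy_seq :: "real \<Rightarrow> (nat \<Rightarrow> real ^ 'n) \<Rightarrow> bool" where
  "greedy_energy_seq s a \<longleftrightarrow>
     range a \<subseteq> sphere 0 1 \<and>
     (\<forall>m\<ge>1. \<forall>x\<in>sphere 0 1.
        (\<Sum>k<m. norm (x - a k) powr s) \<le> (\<Sum>k<m. norm (a m - a k) powr s))"

text \<open>
  \<open>H2 N y\<close> is the energy of the configuration \<open>(y 0, \<dots>, y (N - 1))\<close>, over ordered pairs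
  of distinct indices.
\<close>
definition H2 :: "nat \<Rightarrow> (nat \<Rightarrow> real ^ 'n) \<Rightarrow> real" where
  "H2 N y = (\<Sum>(i, j) \<in> {(i, j). i < N \<and> j < N \<and> i \<noteq> j}. (norm (y i - y j))\<^sup>2)"

definition U2 :: "(nat \<Rightarrow> real ^ 'n) \<Rightarrow> nat \<Rightarrow> real ^ 'n \<Rightarrow> real" where
  "U2 a m x = (\<Sum>k<m. (norm (x - a k))\<^sup>2)"

end

theory Submission
  imports Defs
begin

text \<open>
  For the exponent 2, expanding \<open>(norm (x - a k))\<^sup>2\<close> as an inner product on the unit sphere makes
  everything a function of the partial sums \<open>S m = (\<Sum>k<m. a k)\<close>: the potential at a unit vector \<open>x\<close>
  is \<open>2 * m - 2 * (x \<bullet> S m)\<close>, and the energy of the first \<open>N\<close> points is \<open>2 * N\<^sup>2 - 2 * (norm (S N))\<^sup>2\<close>.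
  Hence greediness says exactly that \<open>a m\<close> minimizes \<open>x \<mapsto> x \<bullet> S m\<close> over the sphere.

  If \<open>S (2 * k) = 0\<close>, every choice of \<open>a (2 * k)\<close> is a minimizer, and then
  \<open>S (2 * k + 1) = a (2 * k)\<close> is a unit vector, whose inner product with a unit vector \<open>x\<close>
  is smallest only at \<open>x = - a (2 * k)\<close>. This choice brings the partial sum back to \<open>0\<close>, so by
  induction the greedy sequences are those made of antipodal pairs. For them \<open>S N\<close> is \<open>0\<close> or
  a unit vector according to the parity of \<open>N\<close>, which gives the exact values of energy and
  potential; as \<open>S N\<close> stays bounded, the leading terms \<open>2 * N\<^sup>2\<close> and \<open>2 * n\<close> determine the limits.
\<close>

section \<open>Squared distances on the unit sphere and partial sums\<close>

lemma norm_diff_unit_squared: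
  fixes x y :: "'a::real_inner"
  assumes "norm x = 1" "norm y = 1"
  shows "(norm (x - y))\<^sup>2 = 2 - 2 * (x \<bullet> y)"
  using assms by (simp add: power2_norm_eq_inner norm_eq_1 inner_diff inner_commute)

lemma sum_norm_diff_unit_squared:
  fixes a :: "nat \<Rightarrow> 'a::real_inner"
  assumes "norm x = 1" "\<And>k. norm (a k) = 1"
  shows "(\<Sum>k<m. (norm (x - a k))\<^sup>2) = 2 * real m - 2 * (x \<bullet> (\<Sum>k<m. a k))"
  using assms
  by (simp add: norm_diff_unit_squared sum_subtractf inner_sum_right sum_distrib_left)

lemma U2_unit:
  assumes "norm x = 1" "\<And>k. norm (a k) = 1"
  shows "U2 a m x = 2 * real m - 2 * (x \<bullet> (\<Sum>k<m. a k))"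
  unfolding U2_def using assms by (rule sum_norm_diff_unit_squared)

lemma H2_unit:
  assumes unit: "\<And>k. norm (a k) = 1"
  shows "H2 N a = 2 * (real N)\<^sup>2 - 2 * (norm (\<Sum>k<N. a k))\<^sup>2"
proof -
  \<comment> \<open>The diagonal terms vanish, so the sum may be taken over the full square of index pairs.\<close>
  have "H2 N a = (\<Sum>(i, j) \<in> {..<N} \<times> {..<N}. (norm (a i - a j))\<^sup>2)"
    unfolding H2_def by (rule sum.mono_neutral_left) auto
  also have "\<dots> = (\<Sum>i<N. \<Sum>j<N. (norm (a i - a j))\<^sup>2)"
    by (simp add: sum.cartesian_product)
  also have "\<dots> = (\<Sum>i<N. 2 * real N - 2 * (a i \<bullet> (\<Sum>k<N. a k)))"
    by (intro sum.cong refl sum_norm_diff_unit_squared unit)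
  also have "\<dots> = 2 * (real N)\<^sup>2 - 2 * ((\<Sum>k<N. a k) \<bullet> (\<Sum>k<N. a k))"
    by (simp add: sum_subtractf power2_eq_square inner_sum_left flip: sum_distrib_left)
  finally show ?thesis
    by (simp add: power2_norm_eq_inner)
qed

text \<open>
  The potential depends on \<open>x\<close> only through a decreasing affine function of \<open>x \<bullet> S m\<close>, so maximizing
  it means minimizing this inner product.
\<close>

lemma greedy_energy_seq_2_iff:
  assumes unit: "\<And>k. norm (a k) = 1"
  shows "greedy_energy_seq 2 a \<longleftrightarrow>
    (\<forall>m\<ge>1. \<forall>x. norm x = 1 \<longrightarrow> a m \<bullet> (\<Sum>k<m. a k) \<le> x \<bullet> (\<Sum>k<m. a k))"
proof -
  have "(\<Sum>k<m. norm (x - a k) powr 2) = 2 * real m - 2 * (x \<bullet> (\<Sum>k<m. a k))"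
    if "norm x = 1" for m x
    using sum_norm_diff_unit_squared[OF that unit] by simp
  then show ?thesis
    unfolding greedy_energy_seq_def using unit by auto
qed

section \<open>Sequences of antipodal pairs\<close>

lemma antipodal_pairs_partial_sum_even:
  fixes a :: "nat \<Rightarrow> 'a::ab_group_add"
  assumes "\<And>k. k < n \<Longrightarrow> a (2 * k + 1) = - a (2 * k)"
  shows "(\<Sum>k<2 * n. a k) = 0"
  using assms by (induction n) auto

lemma antipodal_pairs_partial_sum_odd:
  fixes a :: "nat \<Rightarrow> 'a::ab_group_add"
  assumes "\<And>k. k < n \<Longrightarrow> a (2 * k + 1) = - a (2 * k)"
  shows "(\<Sum>k<2 * n + 1. a k) = a (2 * n)"
  using antipodal_pairs_partial_sum_even[of n a] assms by simp

lemma antipodal_pairs_norm_partial_sum_le_1: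
  fixes a :: "nat \<Rightarrow> 'a::real_normed_vector"
  assumes "\<And>k. norm (a k) = 1" "\<And>k. a (2 * k + 1) = - a (2 * k)"
  shows "norm (\<Sum>k<N. a k) \<le> 1"
proof (cases "even N")
  case True
  then obtain n where "N = 2 * n" ..
  then show ?thesis
    using antipodal_pairs_partial_sum_even[of n a] assms by simp
next
  case False
  then obtain n where "N = 2 * n + 1" ..
  then show ?thesis
    using antipodal_pairs_partial_sum_odd[of n a] assms by simp
qed

text \<open>
  Equality case of the Cauchy--Schwarz inequality: the bound forces \<open>norm (x + y) = 0\<close>.
\<close>

lemma unit_inner_le_minus_1_imp_antipodal:
  fixes x y :: "'a::real_inner"
  assumes "norm x = 1" "norm y = 1" "x \<bullet> y \<le> - 1"
  shows "x = - y"
proof -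
  have "(norm (x + y))\<^sup>2 = 2 + 2 * (x \<bullet> y)"
    using norm_diff_unit_squared[of x "- y"] assms by simp
  then have "(norm (x + y))\<^sup>2 \<le> 0"
    using assms by simp
  then show ?thesis
    by (simp add: eq_neg_iff_add_eq_0)
qed

lemma greedy_energy_seq_2_imp_antipodal:
  assumes unit: "\<And>k. norm (a k) = 1" and "greedy_energy_seq 2 a"
  shows "a (2 * k + 1) = - a (2 * k)"
proof (induction k rule: less_induct)
  case (less k)
  have sum: "(\<Sum>j<2 * k + 1. a j) = a (2 * k)"
    using less by (rule antipodal_pairs_partial_sum_odd)
  \<comment> \<open>The antipode of the previous point is the competitor.\<close>
  have "a (2 * k + 1) \<bullet> (\<Sum>j<2 * k + 1. a j) \<le> (- a (2 * k)) \<bullet> (\<Sum>j<2 * k + 1. a j)"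
    using assms(2) unit unfolding greedy_energy_seq_2_iff[OF unit]
    by (metis le_add2 norm_minus_cancel)
  then have "a (2 * k + 1) \<bullet> a (2 * k) \<le> - 1"
    unfolding sum using unit by (simp add: norm_eq_1)
  then show ?case
    by (intro unit_inner_le_minus_1_imp_antipodal unit)
qed

lemma antipodal_imp_greedy_energy_seq_2:
  fixes a :: "nat \<Rightarrow> real ^ 'n"
  assumes unit: "\<And>k. norm (a k) = 1" and pairs: "\<And>k. a (2 * k + 1) = - a (2 * k)"
  shows "greedy_energy_seq 2 a"
  unfolding greedy_energy_seq_2_iff[OF unit]
proof (intro allI impI)
  fix m :: nat and x :: "real ^ 'n"
  assume x: "norm x = 1"
  show "a m \<bullet> (\<Sum>k<m. a k) \<le> x \<bullet> (\<Sum>k<m. a k)"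
  proof (cases "even m")
    case True
    then obtain n where "m = 2 * n" ..
    then show ?thesis
      using antipodal_pairs_partial_sum_even[of n a] pairs by simp
  next
    case False
    then obtain n where m: "m = 2 * n + 1" ..
    have sum: "(\<Sum>k<m. a k) = a (2 * n)"
      unfolding m using pairs by (rule antipodal_pairs_partial_sum_odd)
    have "a m \<bullet> a (2 * n) = - 1"
      unfolding m pairs using unit by (simp add: norm_eq_1)
    also have "\<dots> \<le> x \<bullet> a (2 * n)"
      using Cauchy_Schwarz_ineq2[of x "a (2 * n)"] x unit by simp
    finally show ?thesis
      unfolding sum .
  qed
qed

section \<open>Energy and potential of antipodal pairs\<close>

text \<open>
  Both limits have the form of a leading term \<open>2 * g n\<close> corrected by a bounded quantity.
\<close>

lemma tendsto_2_of_bounded_correction: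
  fixes g c :: "nat \<Rightarrow> real"
  assumes "filterlim g at_top sequentially" and "\<And>n. \<bar>c n\<bar> \<le> 1"
  shows "(\<lambda>n. (2 * g n - 2 * c n) / g n) \<longlonglongrightarrow> 2"
proof -
  have "(\<lambda>n. c n / g n) \<longlonglongrightarrow> 0"
  proof (rule Lim_null_comparison)
    show "(\<lambda>n. 1 / g n) \<longlonglongrightarrow> 0"
      using assms(1) by (intro tendsto_divide_0[OF tendsto_const] filterlim_at_top_imp_at_infinity)
    show "\<forall>\<^sub>F n in sequentially. norm (c n / g n) \<le> 1 / g n"
      using filterlim_at_top_dense[THEN iffD1, OF assms(1), rule_format, of 0]
      by eventually_elim (use assms(2) in \<open>simp add: divide_right_mono\<close>)
  qed
  then have "(\<lambda>n. 2 - 2 * (c n / g n)) \<longlonglongrightarrow> 2 - 2 * 0"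
    by (intro tendsto_intros)
  moreover have "\<forall>\<^sub>F n in sequentially. 2 - 2 * (c n / g n) = (2 * g n - 2 * c n) / g n"
    using filterlim_at_top_dense[THEN iffD1, OF assms(1), rule_format, of 0]
    by eventually_elim (simp add: field_simps)
  ultimately show ?thesis
    by (auto elim: Lim_transform_eventually)
qed

context
  fixes a :: "nat \<Rightarrow> real ^ 'n"
  assumes unit: "\<And>k. norm (a k) = 1" and pairs: "\<And>k. a (2 * k + 1) = - a (2 * k)"
begin

lemma H2_antipodal_even: "H2 (2 * n) a = 8 * (real n)\<^sup>2"
  using antipodal_pairs_partial_sum_even[of n a] pairs
  by (simp add: H2_unit[OF unit] power2_eq_square)

lemma H2_antipodal_odd: "H2 (2 * n + 1) a = 8 * ((real n)\<^sup>2 + real n)"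
proof -
  have "(\<Sum>k<2 * n + 1. a k) = a (2 * n)"
    using pairs by (rule antipodal_pairs_partial_sum_odd)
  then show ?thesis
    by (simp only: H2_unit[OF unit] unit) (simp add: power2_eq_square algebra_simps)
qed

lemma U2_antipodal_even: "U2 a (2 * n) (a (2 * n)) = 4 * real n"
  using antipodal_pairs_partial_sum_even[of n a] pairs by (simp add: U2_unit unit)

lemma U2_antipodal_odd: "U2 a (2 * n + 1) (a (2 * n + 1)) = 4 * real (n + 1)"
proof -
  have "(\<Sum>k<2 * n + 1. a k) = a (2 * n)"
    using pairs by (rule antipodal_pairs_partial_sum_odd)
  then have "a (2 * n + 1) \<bullet> (\<Sum>k<2 * n + 1. a k) = - 1"
    unfolding pairs using unit by (simp add: norm_eq_1)
  then show ?thesis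
    using U2_unit[of "a (2 * n + 1)" a "2 * n + 1"] unit by simp
qed

lemma H2_antipodal_asymptotics: "(\<lambda>N. H2 N a / (real N)\<^sup>2) \<longlonglongrightarrow> 2"
  unfolding H2_unit[OF unit]
proof (rule tendsto_2_of_bounded_correction)
  show "filterlim (\<lambda>N. (real N)\<^sup>2) at_top sequentially"
    by (intro filterlim_pow_at_top filterlim_real_sequentially) simp
  show "\<bar>(norm (\<Sum>k<N. a k))\<^sup>2\<bar> \<le> 1" for N
    using antipodal_pairs_norm_partial_sum_le_1[of a N, OF unit pairs]
    by (simp add: power_le_one)
qed

lemma U2_antipodal_asymptotics: "(\<lambda>n. U2 a n (a n) / real n) \<longlonglongrightarrow> 2"
  unfolding U2_unit[OF unit unit]
proof (rule tendsto_2_of_bounded_correction[OF filterlim_real_sequentially])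
  show "\<bar>a n \<bullet> (\<Sum>k<n. a k)\<bar> \<le> 1" for n
    using Cauchy_Schwarz_ineq2[of "a n" "\<Sum>k<n. a k"]
      antipodal_pairs_norm_partial_sum_le_1[of a n, OF unit pairs]
    by (simp add: unit)
qed

end

theorem theorem4p1:
  fixes d :: nat and a :: "nat \<Rightarrow> real ^ 'n"
  assumes "d \<ge> 1" and "CARD('n) = d + 1"
    and "range a \<subseteq> sphere 0 1"
  shows "(greedy_energy_seq 2 a \<longleftrightarrow> (\<forall>k. a (2 * k + 1) = - a (2 * k))) \<and>
    (greedy_energy_seq 2 a \<longrightarrow>
       (\<forall>n\<ge>1. H2 (2 * n) a = 8 * (real n)\<^sup>2 \<and>
              H2 (2 * n + 1) a = 8 * ((real n)\<^sup>2 + real n)) \<and>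
       (\<forall>n\<ge>1. U2 a (2 * n - 1) (a (2 * n - 1)) = 4 * real n \<and>
              U2 a (2 * n) (a (2 * n)) = 4 * real n) \<and>
       (\<lambda>N. H2 N a / (real N)\<^sup>2) \<longlonglongrightarrow> 2 \<and>
       (\<lambda>n. U2 a n (a n) / real n) \<longlonglongrightarrow> 2)"
proof -
  have unit: "norm (a k) = 1" for k
    using assms(3) by (auto simp: image_subset_iff)
  have greedy_iff: "greedy_energy_seq 2 a \<longleftrightarrow> (\<forall>k. a (2 * k + 1) = - a (2 * k))"
    using greedy_energy_seq_2_imp_antipodal[of a, OF unit]
      antipodal_imp_greedy_energy_seq_2[of a, OF unit] by blast
  show ?thesis
  proof (intro conjI impI greedy_iff)
    assume "greedy_energy_seq 2 a"
    then have pairs: "a (2 * k + 1) = - a (2 * k)" for k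
      using greedy_iff by blast
    show "\<forall>n\<ge>1. H2 (2 * n) a = 8 * (real n)\<^sup>2 \<and>
        H2 (2 * n + 1) a = 8 * ((real n)\<^sup>2 + real n)"
      using H2_antipodal_even[of a, OF unit pairs] H2_antipodal_odd[of a, OF unit pairs] by blast
    have "U2 a (2 * n - 1) (a (2 * n - 1)) = 4 * real n" if "n \<ge> 1" for n
      using U2_antipodal_odd[of a "n - 1", OF unit pairs] that by (cases n) simp_all
    then show "\<forall>n\<ge>1. U2 a (2 * n - 1) (a (2 * n - 1)) = 4 * real n \<and>
        U2 a (2 * n) (a (2 * n)) = 4 * real n"
      using U2_antipodal_even[of a, OF unit pairs] by blast
    show "(\<lambda>N. H2 N a / (real N)\<^sup>2) \<longlonglongrightarrow> 2"
      by (rule H2_antipodal_asymptotics[OF unit pairs])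
    show "(\<lambda>n. U2 a n (a n) / real n) \<longlonglongrightarrow> 2"
      by (rule U2_antipodal_asymptotics[OF unit pairs])
  qed
qed

end
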